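(* Let $c_1>0$, and for $x\in\mathbb{R}$, $t>0$, $k\in\mathbb{C}$ let $\theta(k)=\theta(x,t,k)=k^2x+2k^4t$. Let $\Sigma^{(1)}_1,\dots,\Sigma^{(8)}_1$ be the fixed rays from the origin described in the context. Then there is a constant $C_0$ (not depending on $x$, $t$ or $k$) such that, for all $t>0$ and all $x$ with $-c_1\sqrt{t}\le x\le c_1\sqrt{t}$: - $|e^{2i\theta(k)}|\le C_0$ for every $k\in\Sigma^{(1)}_1\cup\Sigma^{(3)}_1\cup\Sigma^{(5)}_1\cup\Sigma^{(7)}_1$; - $|e^{-2i\theta(k)}|\le C_0$ for every $k\in\Sigma^{(2)}_1\cup\Sigma^{(4)}_1\cup\Sigma^{(6)}_1\cup\Sigma^{(8)}_1$.
   Context: The contours $\Sigma^{(j)}_1$, $j=1,\dots,8$, are rays in the complex $k$-plane emanating from $k=0$, with directions fixed independently of $x$ and $t$, numbered counter-clockwise. The ray $\Sigma^{(j)}_1$ lies in the open sector $\frac{(j-1)\pi}{4}<\arg k<\frac{j\pi}{4}$, and $\Sigma^{(j+4)}_1=-\Sigma^{(j)}_1$ for $j=1,2,3,4$. (So $\Sigma^{(1)}_1,\Sigma^{(2)}_1$ lie in the first quadrant, $\Sigma^{(3)}_1,\Sigma^{(4)}_1$ in the second, $\Sigma^{(5)}_1,\Sigma^{(6)}_1$ in the third, $\Sigma^{(7)}_1,\Sigma^{(8)}_1$ in the fourth.) *)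

theory Defs
  imports "HOL-Analysis.Analysis"
begin

definition ray_from_origin :: "complex set \<Rightarrow> bool" where
  "ray_from_origin S \<longleftrightarrow> (\<exists>d. d \<noteq> 0 \<and> S = {of_real r * d |r::real. 0 \<le> r})"

(* The library's Arg2pi takes values in [0, 2 pi) and Arg2pi 0 = 0, so the open sectors
   with 1 <= j <= 8 do not contain the origin. *)
definition open_sector :: "nat \<Rightarrow> complex set" where
  "open_sector j = {k. (real j - 1) * pi / 4 < Arg2pi k \<and> Arg2pi k < real j * pi / 4}"

(* Only the values of Sigma at 1, ..., 8 matter.  The rays include their endpoint 0, which
   lies in no open sector and is therefore removed in the sector condition. *)
definition contour_rays :: "(nat \<Rightarrow> complex set) \<Rightarrow> bool" where
  "contour_rays \<Sigma> \<longleftrightarrow>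
     (\<forall>j\<in>{1..8}. ray_from_origin (\<Sigma> j) \<and> \<Sigma> j - {0} \<subseteq> open_sector j) \<and>
     (\<forall>j\<in>{1..4}. \<Sigma> (j + 4) = uminus ` \<Sigma> j)"

definition \<theta> :: "real \<Rightarrow> real \<Rightarrow> complex \<Rightarrow> complex" where
  "\<theta> x t k = k\<^sup>2 * of_real x + 2 * k ^ 4 * of_real t"

end

theory Submission
  imports Defs
begin

text \<open>
  On a ray \<open>k = r d\<close> the modulus of \<open>e\<^sup>\<plusminus>\<^sup>2\<^sup>i\<^sup>\<theta>\<close> is the exponential of a quadratic polynomial in
  \<open>u = r\<^sup>2 \<surd>t\<close>: its linear coefficient is bounded because \<open>\<bar>x\<bar> \<le> c\<^sub>1 \<surd>t\<close>, and its leading coefficient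
  is \<open>\<mp>4 Im d\<^sup>4\<close>, which is negative because \<open>Im d\<^sup>4\<close> has a fixed sign on each open octant.  Such a
  polynomial is bounded above.
\<close>

text \<open>The fourth power multiplies the argument by 4, so sector \<open>Suc n\<close> goes to
  arguments between \<open>n * pi\<close> and \<open>(n + 1) * pi\<close>, where the sine has sign
  \<open>(-1) ^ n\<close>.\<close>

lemma Im_power4_open_sector:
  assumes "k \<in> open_sector (Suc n)"
  shows "(-1) ^ n * Im (k ^ 4) > 0"
proof -
  define \<phi> where "\<phi> = Arg2pi k"
  have \<phi>: "real n * pi < 4 * \<phi>" "4 * \<phi> < real n * pi + pi"
    using assms by (auto simp: open_sector_def \<phi>_def field_simps)
  \<comment> \<open>The shift by \<open>n * pi\<close> moves the angle into (0, pi); undoing it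
    costs the factor cos(n pi) = (-1)^n.\<close>
  then have "sin (4 * \<phi> - real n * pi) > 0"
    by (intro sin_gt_zero) auto
  then have sin_pos: "(-1) ^ n * sin (4 * \<phi>) > 0"
    by (simp add: sin_diff mult.commute)
  \<comment> \<open>Strict positivity of the argument excludes the origin, because
    \<open>Arg2pi 0 = 0\<close>.\<close>
  have "\<phi> \<noteq> 0"
    using \<phi>(1) mult_nonneg_nonneg[OF of_nat_0_le_iff pi_ge_zero, of n] by linarith
  then have "k \<noteq> 0"
    by (auto simp: \<phi>_def)
  have "k = of_real (norm k) * cis \<phi>"
    using Arg2pi_eq[of k] by (simp add: \<phi>_def cis_conv_exp)
  then have "k ^ 4 = (of_real (norm k) * cis \<phi>) ^ 4"
    by simp
  then have "k ^ 4 = of_real (norm k ^ 4) * cis (4 * \<phi>)"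
    using Complex.DeMoivre[of \<phi> 4] by (simp add: power_mult_distrib)
  then have "Im (k ^ 4) = norm k ^ 4 * sin (4 * \<phi>)"
    by (simp del: of_real_power)
  then have "(-1) ^ n * Im (k ^ 4) = norm k ^ 4 * ((-1) ^ n * sin (4 * \<phi>))"
    by simp
  also have "\<dots> > 0"
    using \<open>k \<noteq> 0\<close> by (intro mult_pos_pos[OF _ sin_pos]) simp
  finally show ?thesis .
qed

text \<open>Completing the square; the bound is the value at the vertex u = a / (2b).\<close>

lemma linear_minus_quadratic_le:
  fixes a b u :: real
  assumes "b > 0"
  shows "a * u - b * u\<^sup>2 \<le> a\<^sup>2 / (4 * b)"
proof -
  have "a\<^sup>2 / (4 * b) - (a * u - b * u\<^sup>2) = (a - 2 * b * u)\<^sup>2 / (4 * b)"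
    using assms by (simp add: field_simps power2_eq_square)
  moreover have "\<dots> \<ge> 0"
    using assms by simp
  ultimately show ?thesis
    by linarith
qed

text \<open>The sign \<open>s\<close> treats both exponentials at once. The bound involves only
  \<open>c\<close>, \<open>s\<close> and the direction \<open>d\<close>, hence is uniform in
  \<open>r\<close>, \<open>t\<close> and \<open>x\<close>.\<close>

lemma norm_exp_\<theta>_le:
  assumes s: "\<bar>s\<bar> = 1" and d: "s * Im (d ^ 4) > 0" and t: "t \<ge> 0" and x: "\<bar>x\<bar> \<le> c * sqrt t"
  shows "norm (exp (of_real s * 2 * \<i> * \<theta> x t (of_real r * d)))
           \<le> exp ((2 * c * \<bar>Im (d\<^sup>2)\<bar>)\<^sup>2 / (4 * (4 * (s * Im (d ^ 4)))))"
proof -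
  define u where "u = r\<^sup>2 * sqrt t"
  have u2: "u\<^sup>2 = r ^ 4 * t"
    using t by (simp add: u_def power_mult_distrib flip: power_mult)
  \<comment> \<open>Collecting the real factors under \<open>of_real\<close> lets \<open>Im\<close>
    act linearly, with the powers of \<open>d\<close> left unexpanded.\<close>
  have "\<theta> x t (of_real r * d)
      = of_real (r\<^sup>2 * x) * d\<^sup>2 + of_real (2 * r ^ 4 * t) * d ^ 4"
    by (simp add: \<theta>_def power_mult_distrib mult_ac)
  then have "Im (\<theta> x t (of_real r * d)) = r\<^sup>2 * x * Im (d\<^sup>2) + 2 * r ^ 4 * t * Im (d ^ 4)"
    by (simp only: plus_complex.sel Im_complex_of_real Re_complex_of_real times_complex.sel mult_zero_left add_0_right)
  moreover have "Re (of_real s * 2 * \<i> * z) = - 2 * s * Im z" for z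
    by simp
  ultimately have "Re (of_real s * 2 * \<i> * \<theta> x t (of_real r * d))
      = - 2 * s * (r\<^sup>2 * x * Im (d\<^sup>2)) - 4 * (s * Im (d ^ 4)) * u\<^sup>2"
    by (simp only: u2) (simp add: algebra_simps)
  \<comment> \<open>The signs of \<open>x\<close> and of Im(d^2) are arbitrary, so this term is
    estimated by its absolute value.\<close>
  moreover have "- 2 * s * (r\<^sup>2 * x * Im (d\<^sup>2)) \<le> 2 * c * \<bar>Im (d\<^sup>2)\<bar> * u"
  proof -
    have "- 2 * s * (r\<^sup>2 * x * Im (d\<^sup>2)) \<le> \<bar>- 2 * s * (r\<^sup>2 * x * Im (d\<^sup>2))\<bar>"
      by (rule abs_ge_self)
    also have "\<dots> = 2 * r\<^sup>2 * \<bar>Im (d\<^sup>2)\<bar> * \<bar>x\<bar>"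
      using s by (simp add: abs_mult)
    also have "\<dots> \<le> 2 * r\<^sup>2 * \<bar>Im (d\<^sup>2)\<bar> * (c * sqrt t)"
      using x by (intro mult_left_mono) auto
    finally show ?thesis
      by (simp add: u_def mult_ac)
  qed
  moreover have "2 * c * \<bar>Im (d\<^sup>2)\<bar> * u - 4 * (s * Im (d ^ 4)) * u\<^sup>2
      \<le> (2 * c * \<bar>Im (d\<^sup>2)\<bar>)\<^sup>2 / (4 * (4 * (s * Im (d ^ 4))))"
    using d by (intro linear_minus_quadratic_le) simp
  ultimately show ?thesis
    by (simp only: norm_exp_eq_Re exp_le_cancel_iff)
qed

text \<open>Counting rays from \<open>Suc n\<close> makes \<open>(-1) ^ n\<close> the sign of the
  exponent: plus on odd-numbered rays, minus on even-numbered ones.\<close>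

lemma contour_ray_bound:
  assumes "contour_rays \<Sigma>" and "Suc n \<in> {1..8}"
  shows "\<exists>C. \<forall>t x. t > 0 \<and> - c * sqrt t \<le> x \<and> x \<le> c * sqrt t \<longrightarrow>
           (\<forall>k\<in>\<Sigma> (Suc n). norm (exp (of_real ((-1) ^ n) * 2 * \<i> * \<theta> x t k)) \<le> C)"
proof -
  have ray: "ray_from_origin (\<Sigma> (Suc n))" and sub: "\<Sigma> (Suc n) - {0} \<subseteq> open_sector (Suc n)"
    using assms by (auto simp only: contour_rays_def)
  from ray obtain d where d: "d \<noteq> 0" "\<Sigma> (Suc n) = {of_real r * d |r::real. 0 \<le> r}"
    unfolding ray_from_origin_def by blast
  \<comment> \<open>The parameter r = 1 puts the direction vector on its own ray, so the sector
    condition applies to it.\<close>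
  have "d \<in> \<Sigma> (Suc n)"
    unfolding d(2) by (auto intro!: exI[of _ 1])
  with d(1) sub have pos: "(-1) ^ n * Im (d ^ 4) > 0"
    by (intro Im_power4_open_sector) auto
  have "norm (exp (of_real ((-1) ^ n) * 2 * \<i> * \<theta> x t k))
      \<le> exp ((2 * c * \<bar>Im (d\<^sup>2)\<bar>)\<^sup>2 / (4 * (4 * ((-1) ^ n * Im (d ^ 4)))))"
    if "t > 0" "- c * sqrt t \<le> x" "x \<le> c * sqrt t" and k: "k \<in> \<Sigma> (Suc n)" for t x k
  proof -
    from k d(2) obtain r where r: "k = of_real r * d"
      by auto
    show ?thesis
      unfolding r using that(1-3) pos by (intro norm_exp_\<theta>_le) auto
  qed
  then show ?thesis
    by blast
qed

theorem proposition4p1: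
  fixes c\<^sub>1 :: real and \<Sigma> :: "nat \<Rightarrow> complex set"
  assumes "c\<^sub>1 > 0" and "contour_rays \<Sigma>"
  shows "\<exists>C\<^sub>0::real. \<forall>(t::real) (x::real). t > 0 \<and> - c\<^sub>1 * sqrt t \<le> x \<and> x \<le> c\<^sub>1 * sqrt t \<longrightarrow>
           (\<forall>k \<in> \<Sigma> 1 \<union> \<Sigma> 3 \<union> \<Sigma> 5 \<union> \<Sigma> 7. norm (exp (2 * \<i> * \<theta> x t k)) \<le> C\<^sub>0) \<and>
           (\<forall>k \<in> \<Sigma> 2 \<union> \<Sigma> 4 \<union> \<Sigma> 6 \<union> \<Sigma> 8. norm (exp (- 2 * \<i> * \<theta> x t k)) \<le> C\<^sub>0)"
proof -
  have "\<forall>n\<in>{..<8}. \<exists>C. \<forall>t x. t > 0 \<and> - c\<^sub>1 * sqrt t \<le> x \<and> x \<le> c\<^sub>1 * sqrt t \<longrightarrow>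
      (\<forall>k\<in>\<Sigma> (Suc n). norm (exp (of_real ((-1) ^ n) * 2 * \<i> * \<theta> x t k)) \<le> C)"
    using contour_ray_bound[OF assms(2)] by auto
  then obtain C where C: "\<And>n t x k. n < 8 \<Longrightarrow> t > 0 \<Longrightarrow> - c\<^sub>1 * sqrt t \<le> x \<Longrightarrow> x \<le> c\<^sub>1 * sqrt t \<Longrightarrow>
      k \<in> \<Sigma> (Suc n) \<Longrightarrow> norm (exp (of_real ((-1) ^ n) * 2 * \<i> * \<theta> x t k)) \<le> C n"
    unfolding bchoice_iff by (metis lessThan_iff)
  \<comment> \<open>There are only eight rays, so the largest of their constants serves for all of
    them.\<close>
  define C\<^sub>0 where "C\<^sub>0 = Max (C ` {..<8})"
  have le: "norm (exp (of_real ((-1) ^ n) * 2 * \<i> * \<theta> x t k)) \<le> C\<^sub>0"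
    if "n < 8" "t > 0" "- c\<^sub>1 * sqrt t \<le> x" "x \<le> c\<^sub>1 * sqrt t" "k \<in> \<Sigma> (Suc n)" for n t x k
  proof -
    have "C n \<le> C\<^sub>0"
      using that(1) by (auto simp: C\<^sub>0_def)
    with C[OF that] show ?thesis
      by linarith
  qed
  show ?thesis
  proof (intro exI allI impI conjI ballI)
    fix t x k
    assume tx: "t > 0 \<and> - c\<^sub>1 * sqrt t \<le> x \<and> x \<le> c\<^sub>1 * sqrt t"
    show "norm (exp (2 * \<i> * \<theta> x t k)) \<le> C\<^sub>0" if "k \<in> \<Sigma> 1 \<union> \<Sigma> 3 \<union> \<Sigma> 5 \<union> \<Sigma> 7"
      using that tx le[of 0 t x k] le[of 2 t x k] le[of 4 t x k] le[of 6 t x k] by auto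
    show "norm (exp (- 2 * \<i> * \<theta> x t k)) \<le> C\<^sub>0" if "k \<in> \<Sigma> 2 \<union> \<Sigma> 4 \<union> \<Sigma> 6 \<union> \<Sigma> 8"
      using that tx le[of 1 t x k] le[of 3 t x k] le[of 5 t x k] le[of 7 t x k]
      by (auto simp: eval_nat_numeral)
  qed
qed

end
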